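(* There exists a numerical constant $c>0$ such that for any $\alpha,\sigma>0$ there exists a constant $C_{\alpha\sigma}$, depending only on $\alpha,\sigma$, such that for all $n\ge C_{\alpha\sigma}$, $$\inf_{\hat\pi}\ \sup_{\pi}\ \mathbb P_{(F_\alpha,\pi)}\Big\{L_{\max}(\hat\pi,\pi)\ \ge\ c\,\frac{\sigma}{\alpha}\sqrt{\frac{\log n}{n}}\Big\}\ \ge\ \frac12,$$ where the infimum is over all estimators $\hat\pi$ (measurable functions of the observed matrix $A$ with values in $\mathbb R^n$), the supremum is over all permutations $\pi$ of $[n]$, and $F_\alpha$ is the known matrix $(F_\alpha)_{ij}=1-\alpha|i-j|/n$, $i,j\in[n]$.
   Context: $[n]=\{1,\dots,n\}$. For a permutation $\pi$ of $[n]$, $(F_\pi)_{ij}=F_{\pi_i\pi_j}$. $\mathbb P_{(F,\pi)}$ is the distribution of the observed symmetric matrix $A=F_\pi+\sigma E$, where $E$ is a symmetric $n\times n$ random matrix with independent standard Gaussian $N(0,1)$ entries $E_{ij}$, $i\le j$. The loss is $$L_{\max}(\hat\pi,\pi)=\frac1n\min\Big(\max_{i\in[n]}|\hat\pi_i-\pi_i|,\ \max_{i\in[n]}|\hat\pi_i-\pi_i^{\mathrm{rev}}|\Big),\qquad \pi_i^{\mathrm{rev}}=n+1-\pi_i .$$ *)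

theory Defs
  imports "HOL-Probability.Probability" "HOL-Combinatorics.Permutations"
begin

text \<open>An \<open>n \<times> n\<close> matrix is an extensional function on \<open>[n] \<times> [n]\<close>, and a vector of \<open>\<real>\<^sup>n\<close> an
  extensional function on \<open>[n]\<close>, where \<open>[n] = {1..n}\<close>. Both carry the product (= Borel)
  \<open>\<sigma>\<close>-algebra.\<close>

definition matrix_space :: "nat \<Rightarrow> (nat \<times> nat \<Rightarrow> real) measure" where
  "matrix_space n = (\<Pi>\<^sub>M p\<in>{1..n} \<times> {1..n}. borel)"

definition vector_space_n :: "nat \<Rightarrow> (nat \<Rightarrow> real) measure" where
  "vector_space_n n = (\<Pi>\<^sub>M i\<in>{1..n}. borel)"

definition upper_indices :: "nat \<Rightarrow> (nat \<times> nat) set" where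
  "upper_indices n = {(i, j). 1 \<le> i \<and> i \<le> j \<and> j \<le> n}"

definition std_gaussian :: "real measure" where
  "std_gaussian = density lborel (\<lambda>x. ennreal (std_normal_density x))"

text \<open>Joint law of the independent entries \<open>E\<^sub>i\<^sub>j\<close>, \<open>i \<le> j\<close>, diagonal included.\<close>

definition upper_noise :: "nat \<Rightarrow> (nat \<times> nat \<Rightarrow> real) measure" where
  "upper_noise n = (\<Pi>\<^sub>M p\<in>upper_indices n. std_gaussian)"

text \<open>The entries below the diagonal are the mirror images of those above it.\<close>

definition symmetrize :: "(nat \<times> nat \<Rightarrow> real) \<Rightarrow> nat \<Rightarrow> nat \<Rightarrow> real" where
  "symmetrize e i j = e (min i j, max i j)"

definition permuted_matrix :: "(nat \<Rightarrow> nat \<Rightarrow> real) \<Rightarrow> (nat \<Rightarrow> nat) \<Rightarrow> nat \<Rightarrow> nat \<Rightarrow> real" where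
  "permuted_matrix F \<pi> i j = F (\<pi> i) (\<pi> j)"

definition observation ::
  "nat \<Rightarrow> real \<Rightarrow> (nat \<Rightarrow> nat \<Rightarrow> real) \<Rightarrow> (nat \<Rightarrow> nat) \<Rightarrow> (nat \<times> nat \<Rightarrow> real) \<Rightarrow> nat \<times> nat \<Rightarrow> real" where
  "observation n \<sigma> F \<pi> e =
     (\<lambda>(i, j) \<in> {1..n} \<times> {1..n}. permuted_matrix F \<pi> i j + \<sigma> * symmetrize e i j)"

text \<open>The law \<open>P\<^sub>(\<^sub>F\<^sub>,\<^sub>\<pi>\<^sub>)\<close> of the observed matrix \<open>A = F\<^sub>\<pi> + \<sigma> E\<close>.\<close>

definition observation_law ::
  "nat \<Rightarrow> real \<Rightarrow> (nat \<Rightarrow> nat \<Rightarrow> real) \<Rightarrow> (nat \<Rightarrow> nat) \<Rightarrow> (nat \<times> nat \<Rightarrow> real) measure" where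
  "observation_law n \<sigma> F \<pi> = distr (upper_noise n) (matrix_space n) (observation n \<sigma> F \<pi>)"

definition estimators :: "nat \<Rightarrow> ((nat \<times> nat \<Rightarrow> real) \<Rightarrow> nat \<Rightarrow> real) set" where
  "estimators n = matrix_space n \<rightarrow>\<^sub>M vector_space_n n"

definition rev_perm :: "nat \<Rightarrow> (nat \<Rightarrow> nat) \<Rightarrow> nat \<Rightarrow> real" where
  "rev_perm n \<pi> i = real n + 1 - real (\<pi> i)"

definition L_max :: "nat \<Rightarrow> (nat \<Rightarrow> real) \<Rightarrow> (nat \<Rightarrow> nat) \<Rightarrow> real" where
  "L_max n v \<pi> = 1 / real n *
     min (MAX i\<in>{1..n}. \<bar>v i - real (\<pi> i)\<bar>) (MAX i\<in>{1..n}. \<bar>v i - rev_perm n \<pi> i\<bar>)"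

definition F_lin :: "nat \<Rightarrow> real \<Rightarrow> nat \<Rightarrow> nat \<Rightarrow> real" where
  "F_lin n \<alpha> i j = 1 - \<alpha> * \<bar>real i - real j\<bar> / real n"

text \<open>The infimum and supremum in the theorem are taken in the reals and the probabilities are
  values of \<open>measure\<close>. The following facts ensure that none of these is a junk value.\<close>

lemma prob_space_upper_noise: "prob_space (upper_noise n)"
  unfolding upper_noise_def std_gaussian_def
  by (intro prob_space_PiM prob_space_normal_density) simp

lemma measurable_observation: "observation n \<sigma> F \<pi> \<in> upper_noise n \<rightarrow>\<^sub>M matrix_space n"
proof -
  have *: "(\<lambda>e. e (min i j, max i j)) \<in> upper_noise n \<rightarrow>\<^sub>M borel"
    if "i \<in> {1..n}" "j \<in> {1..n}" for i j
  proof -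
    have "(min i j, max i j) \<in> upper_indices n"
      using that by (auto simp: upper_indices_def)
    then have "(\<lambda>e. e (min i j, max i j)) \<in> upper_noise n \<rightarrow>\<^sub>M std_gaussian"
      unfolding upper_noise_def by (rule measurable_component_singleton)
    then show ?thesis by (simp add: std_gaussian_def cong: measurable_cong_sets)
  qed
  show ?thesis
    unfolding matrix_space_def observation_def symmetrize_def
    by (rule measurable_restrict) (auto intro!: borel_measurable_add borel_measurable_times *)
qed

lemma prob_space_observation_law: "prob_space (observation_law n \<sigma> F \<pi>)"
  unfolding observation_law_def
  by (rule prob_space.prob_space_distr[OF prob_space_upper_noise measurable_observation])

lemma sets_observation_law: "sets (observation_law n \<sigma> F \<pi>) = sets (matrix_space n)"
  by (simp add: observation_law_def)

lemma loss_event_in_sets: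
  assumes "h \<in> estimators n"
  shows "{A \<in> space (observation_law n \<sigma> F \<pi>). L_max n (h A) \<pi> \<ge> t} \<in> sets (observation_law n \<sigma> F \<pi>)"
proof -
  define P where "P = observation_law n \<sigma> F \<pi>"
  have h: "h \<in> P \<rightarrow>\<^sub>M (\<Pi>\<^sub>M i\<in>{1..n}. borel)"
    using assms by (simp add: P_def estimators_def vector_space_n_def observation_law_def)
  have comp: "(\<lambda>A. h A i) \<in> borel_measurable P" if "i \<in> {1..n}" for i
    by (rule measurable_compose[OF h measurable_component_singleton[OF that]])
  have "(\<lambda>A. MAX i\<in>{1..n}. \<bar>h A i - g i\<bar>) \<in> borel_measurable P" for g :: "nat \<Rightarrow> real"
    by (rule borel_measurable_Max)
       (simp_all only: finite_atLeastAtMost borel_measurable_abs borel_measurable_diff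
         borel_measurable_const comp)
  note max = this
  have loss: "(\<lambda>A. L_max n (h A) \<pi>) \<in> borel_measurable P"
    unfolding L_max_def
    by (rule borel_measurable_times[OF borel_measurable_const borel_measurable_min[OF max max]])
  have "{A \<in> space P. t \<le> L_max n (h A) \<pi>} \<in> sets P"
    by (rule borel_measurable_le[OF borel_measurable_const loss])
  then show ?thesis by (simp add: P_def)
qed

lemma estimators_nonempty: "estimators n \<noteq> {}"
proof -
  have "(\<lambda>_. \<lambda>i\<in>{1..n}. 0) \<in> estimators n"
    by (auto simp: estimators_def vector_space_n_def space_PiM)
  then show ?thesis by blast
qed

end

theory Submission
  imports Defs "HOL-Real_Asymp.Real_Asymp"
begin

text \<open>
  Compare transpositions with the identity permutation: with \<open>k\<close> of order
  \<open>(\<sigma> / \<alpha>) sqrt (n log n)\<close>, the transpositions \<open>\<tau>\<^sub>j = (j, j + k)\<close> for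
  \<open>j = 1, \<dots>, k\<close> are pairwise \<open>k / n\<close>-separated, so that an estimator can be accurate for at
  most one of them. Each \<open>\<tau>\<^sub>j\<close> changes only two rows and columns of the mean matrix,
  by \<open>O(\<alpha> k / n)\<close> per entry, so the likelihood ratio of \<open>\<tau>\<^sub>j\<close> against the identity has second
  moment at most \<open>K = exp (O(\<alpha>\<^sup>2 k\<^sup>2 / (\<sigma>\<^sup>2 n)))\<close>, a small power of \<open>n\<close>.
  If the estimator were accurate with probability above \<open>1 / 2\<close> under every \<open>\<tau>\<^sub>j\<close>, then under
  the identity the \<open>k\<close> disjoint accuracy events would each have probability at least
  \<open>1 / (4 K)\<close>, which is impossible because \<open>k > 4 K\<close> for large \<open>n\<close>.
\<close>

section \<open>Gaussian likelihood ratios under a shift of the mean\<close>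

lemma space_std_gaussian [simp]: "space std_gaussian = UNIV"
  by (simp add: std_gaussian_def)

lemma sets_std_gaussian [simp, measurable_cong]: "sets std_gaussian = sets borel"
  by (simp add: std_gaussian_def)

lemma prob_space_std_gaussian: "prob_space std_gaussian"
  unfolding std_gaussian_def by (rule prob_space_normal_density) simp

lemma std_normal_density_shift:
  "std_normal_density (x - d) = std_normal_density x * exp (d * x - d\<^sup>2 / 2)"
proof -
  have "exp (- (x - d)\<^sup>2 / 2) = exp (- x\<^sup>2 / 2) * exp (d * x - d\<^sup>2 / 2)"
    by (simp add: mult_exp_exp power2_eq_square field_simps)
  then show ?thesis
    by (simp add: std_normal_density_def)
qed

text \<open>Likelihood ratio of \<open>N(d, 1)\<close> against \<open>N(0, 1)\<close>.\<close>

definition tilt :: "real \<Rightarrow> real \<Rightarrow> ennreal" where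
  "tilt d x = ennreal (exp (d * x - d\<^sup>2 / 2))"

lemma borel_measurable_tilt [measurable]: "tilt d \<in> borel_measurable borel"
  unfolding tilt_def by measurable

text \<open>The factor \<open>tilt d\<close> moves the density to mean \<open>d\<close>; translation
  invariance of Lebesgue measure then moves the shift onto \<open>f\<close>.\<close>

lemma nn_integral_tilt:
  assumes [measurable]: "f \<in> borel_measurable borel"
  shows "(\<integral>\<^sup>+x. tilt d x * f x \<partial>std_gaussian) = (\<integral>\<^sup>+x. f (x + d) \<partial>std_gaussian)"
proof -
  have "(\<integral>\<^sup>+x. tilt d x * f x \<partial>std_gaussian)
      = (\<integral>\<^sup>+x. ennreal (std_normal_density x) * (tilt d x * f x) \<partial>lborel)"
    unfolding std_gaussian_def by (subst nn_integral_density) auto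
  also have "\<dots> = (\<integral>\<^sup>+x. ennreal (std_normal_density (x - d)) * f x \<partial>lborel)"
    by (simp add: std_normal_density_shift tilt_def ennreal_mult mult.assoc)
  also have "\<dots> = (\<integral>\<^sup>+x. ennreal (std_normal_density x) * f (x + d) \<partial>lborel)"
    by (subst nn_integral_real_affine[where c = 1 and t = d]) (auto simp: add.commute)
  also have "\<dots> = (\<integral>\<^sup>+x. f (x + d) \<partial>std_gaussian)"
    unfolding std_gaussian_def by (subst nn_integral_density) auto
  finally show ?thesis .
qed

text \<open>One factor \<open>tilt d\<close> acts as a change of measure and shifts the argument of
  the other, which thereby gains the constant \<open>exp (d\<^sup>2)\<close>; what remains is a
  likelihood ratio and integrates to 1.\<close>

lemma nn_integral_tilt_sq: "(\<integral>\<^sup>+x. (tilt d x)\<^sup>2 \<partial>std_gaussian) = ennreal (exp (d\<^sup>2))"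
proof -
  interpret prob_space std_gaussian by (rule prob_space_std_gaussian)
  have "tilt d (x + d) = ennreal (exp (d\<^sup>2)) * tilt d x" for x
    unfolding tilt_def
    by (subst ennreal_mult[symmetric])
       (auto simp: mult_exp_exp power2_eq_square algebra_simps)
  moreover have "(\<integral>\<^sup>+x. tilt d x \<partial>std_gaussian) = 1"
    using nn_integral_tilt[of "\<lambda>_. 1" d] emeasure_space_1 by simp
  ultimately show ?thesis
    using nn_integral_tilt[of "tilt d" d]
    by (simp add: power2_eq_square nn_integral_cmult)
qed

text \<open>A finite-dimensional Cameron-Martin formula. Both measures assign to every box the
  product of the shifted coordinate laws \<open>S i\<close>, and a product measure is determined by
  its values on boxes.\<close>

lemma distr_gaussian_shift:
  assumes "finite I"
  shows "distr (\<Pi>\<^sub>M i\<in>I. std_gaussian) (\<Pi>\<^sub>M i\<in>I. std_gaussian) (\<lambda>e. \<lambda>i\<in>I. e i + d i)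
    = density (\<Pi>\<^sub>M i\<in>I. std_gaussian) (\<lambda>e. \<Prod>i\<in>I. tilt (d i) (e i))"
    (is "distr ?P ?P ?s = density ?P ?l")
proof -
  define S where "S i = distr std_gaussian std_gaussian (\<lambda>x. x + d i)" for i
  interpret G: product_prob_space "\<lambda>_. std_gaussian" I
    by (intro product_prob_spaceI prob_space_std_gaussian)
  have PS: "prob_space (S i)" for i
    unfolding S_def by (rule prob_space.prob_space_distr[OF prob_space_std_gaussian]) simp
  interpret S: product_prob_space S I
    using PS by (intro product_prob_spaceI) auto
  have setsS: "sets (S i) = sets borel" for i by (simp add: S_def)
  have s [measurable]: "?s \<in> ?P \<rightarrow>\<^sub>M ?P" by measurable
  have cong: "sets (Pi\<^sub>M I S) = sets ?P" by (rule sets_PiM_cong) (simp_all add: setsS)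
  have emS: "emeasure (S i) X = (\<integral>\<^sup>+x. tilt (d i) x * indicator X x \<partial>std_gaussian)"
    if [measurable]: "X \<in> sets borel" for i X
    unfolding S_def
    using nn_integral_tilt[of "indicator X" "d i"]
    by (simp add: nn_integral_indicator[symmetric] nn_integral_distr del: nn_integral_indicator)
  have 1: "distr ?P ?P ?s = Pi\<^sub>M I S"
  proof (rule S.PiM_eqI)
    fix A assume A: "\<And>i. i \<in> I \<Longrightarrow> A i \<in> sets (S i)"
    have [measurable]: "A i \<in> sets borel" if "i \<in> I" for i using A that setsS by simp
    have "emeasure (distr ?P ?P ?s) (Pi\<^sub>E I A) = emeasure ?P (?s -` Pi\<^sub>E I A \<inter> space ?P)"
      by (rule emeasure_distr) (use assms in \<open>auto intro!: sets_PiM_I_finite\<close>)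
    also have "?s -` Pi\<^sub>E I A \<inter> space ?P = Pi\<^sub>E I (\<lambda>i. (\<lambda>x. x + d i) -` A i)"
      by (auto simp: space_PiM PiE_def Pi_def extensional_def)
    also have "emeasure ?P \<dots> = (\<Prod>i\<in>I. emeasure std_gaussian ((\<lambda>x. x + d i) -` A i))"
      by (rule G.emeasure_PiM[OF assms]) (simp add: measurable_sets_borel[OF borel_measurable_add])
    also have "\<dots> = (\<Prod>i\<in>I. emeasure (S i) (A i))"
      by (intro prod.cong) (simp_all add: S_def emeasure_distr)
    finally show "emeasure (distr ?P ?P ?s) (Pi\<^sub>E I A) = (\<Prod>i\<in>I. emeasure (S i) (A i))" .
  qed (use assms cong in auto)
  have 2: "density ?P ?l = Pi\<^sub>M I S"
  proof (rule S.PiM_eqI)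
    fix A assume A: "\<And>i. i \<in> I \<Longrightarrow> A i \<in> sets (S i)"
    have [measurable]: "A i \<in> sets borel" if "i \<in> I" for i using A that setsS by simp
    have "emeasure (density ?P ?l) (Pi\<^sub>E I A) = (\<integral>\<^sup>+e. ?l e * indicator (Pi\<^sub>E I A) e \<partial>?P)"
      by (rule emeasure_density) (use assms in \<open>auto intro!: sets_PiM_I_finite\<close>)
    also have "\<dots> = (\<integral>\<^sup>+e. (\<Prod>i\<in>I. tilt (d i) (e i) * indicator (A i) (e i)) \<partial>?P)"
    proof (rule nn_integral_cong)
      fix e assume "e \<in> space ?P"
      then have "e \<in> Pi\<^sub>E I A \<longleftrightarrow> (\<forall>i\<in>I. e i \<in> A i)" by (auto simp: space_PiM PiE_def)
      then have "indicator (Pi\<^sub>E I A) e = (\<Prod>i\<in>I. indicator (A i) (e i) :: ennreal)"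
        using assms by (auto simp: indicator_def)
      then show "?l e * indicator (Pi\<^sub>E I A) e = (\<Prod>i\<in>I. tilt (d i) (e i) * indicator (A i) (e i))"
        by (simp add: prod.distrib)
    qed
    also have "\<dots> = (\<Prod>i\<in>I. \<integral>\<^sup>+x. tilt (d i) x * indicator (A i) x \<partial>std_gaussian)"
      by (rule G.product_nn_integral_prod[OF assms]) simp
    also have "\<dots> = (\<Prod>i\<in>I. emeasure (S i) (A i))"
      by (intro prod.cong) (simp_all add: emS)
    finally show "emeasure (density ?P ?l) (Pi\<^sub>E I A) = (\<Prod>i\<in>I. emeasure (S i) (A i))" .
  qed (use assms cong in auto)
  show ?thesis using 1 2 by simp
qed

text \<open>The AM-GM inequality that lets a second moment control a likelihood ratio on an
  event.\<close>

lemma le_sq_over_4K: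
  fixes l K :: real
  assumes "K > 0"
  shows "l \<le> l\<^sup>2 / (4 * K) + K"
proof -
  have "0 \<le> (l - 2 * K)\<^sup>2" by simp
  then show ?thesis using assms by (simp add: field_simps power2_eq_square)
qed

text \<open>Integrating the pointwise bound \<open>l \<le> l\<^sup>2 / (4 * K) + K\<close> over
  \<open>B\<close> plays the role of Cauchy-Schwarz but gives a bound linear in the probability of
  \<open>B\<close>. The second moment of the likelihood ratio is at most \<open>K\<close>, so the
  quadratic term contributes at most 1/4.\<close>

lemma measure_gaussian_shift_le:
  assumes "finite I" "B \<in> sets (\<Pi>\<^sub>M i\<in>I. std_gaussian)" "K \<ge> exp (\<Sum>i\<in>I. (d i)\<^sup>2)"
  shows "measure (\<Pi>\<^sub>M i\<in>I. std_gaussian)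
      ((\<lambda>e. \<lambda>i\<in>I. e i + d i) -` B \<inter> space (\<Pi>\<^sub>M i\<in>I. std_gaussian))
    \<le> 1 / 4 + K * measure (\<Pi>\<^sub>M i\<in>I. std_gaussian) B"
    (is "measure ?P (?s -` B \<inter> _) \<le> _")
proof -
  interpret G: product_prob_space "\<lambda>_. std_gaussian" I
    by (intro product_prob_spaceI prob_space_std_gaussian)
  note [measurable] = assms(2)
  define l where "l e = exp (\<Sum>i\<in>I. d i * e i - (d i)\<^sup>2 / 2)" for e
  have l: "(\<Prod>i\<in>I. tilt (d i) (e i)) = ennreal (l e)" for e
    by (simp add: tilt_def l_def exp_sum[OF assms(1)] prod_ennreal)
  have lm [measurable]: "l \<in> borel_measurable ?P" unfolding l_def by measurable
  have K: "K > 0" using assms(3) exp_gt_zero less_le_trans by blast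
  have "emeasure ?P (?s -` B \<inter> space ?P) = emeasure (distr ?P ?P ?s) B"
    by (rule emeasure_distr[symmetric]) measurable
  also have "\<dots> = (\<integral>\<^sup>+e. ennreal (l e) * indicator B e \<partial>?P)"
    unfolding distr_gaussian_shift[OF assms(1)] l by (rule emeasure_density) measurable
  \<comment> \<open>The indicator is dropped from the quadratic term only, so that its integral
    factorises over the coordinates.\<close>
  also have "\<dots> \<le> (\<integral>\<^sup>+e. ennreal (1 / (4 * K)) * ennreal ((l e)\<^sup>2) + ennreal K * indicator B e \<partial>?P)"
  proof (rule nn_integral_mono)
    fix e
    have "ennreal (l e) \<le> ennreal ((l e)\<^sup>2 / (4 * K) + K)"
      using le_sq_over_4K[OF K] by (rule ennreal_leI)
    also have "\<dots> = ennreal (1 / (4 * K)) * ennreal ((l e)\<^sup>2) + ennreal K"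
      using K by (simp add: ennreal_mult[symmetric])
    finally show "ennreal (l e) * indicator B e
        \<le> ennreal (1 / (4 * K)) * ennreal ((l e)\<^sup>2) + ennreal K * indicator B e"
      by (simp split: split_indicator)
  qed
  also have "\<dots> = ennreal (1 / (4 * K)) * (\<integral>\<^sup>+e. ennreal ((l e)\<^sup>2) \<partial>?P) + ennreal K * emeasure ?P B"
    by (simp add: nn_integral_add nn_integral_cmult nn_integral_cmult_indicator)
  also have "(\<integral>\<^sup>+e. ennreal ((l e)\<^sup>2) \<partial>?P) = (\<integral>\<^sup>+e. (\<Prod>i\<in>I. (tilt (d i) (e i))\<^sup>2) \<partial>?P)"
    by (simp add: prod_power_distrib[symmetric] l ennreal_power l_def)
  also have "\<dots> = (\<Prod>i\<in>I. \<integral>\<^sup>+x. (tilt (d i) x)\<^sup>2 \<partial>std_gaussian)"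
    by (rule G.product_nn_integral_prod[OF assms(1)]) simp
  also have "\<dots> = ennreal (exp (\<Sum>i\<in>I. (d i)\<^sup>2))"
    by (simp add: nn_integral_tilt_sq exp_sum[OF assms(1)] prod_ennreal)
  also have "ennreal (1 / (4 * K)) * \<dots> + ennreal K * emeasure ?P B
      = ennreal (exp (\<Sum>i\<in>I. (d i)\<^sup>2) / (4 * K) + K * measure ?P B)"
    using K by (simp add: G.P.emeasure_eq_measure ennreal_mult[symmetric] ennreal_plus[symmetric] del: ennreal_plus)
  also have "\<dots> \<le> ennreal (1 / 4 + K * measure ?P B)"
    using assms(3) K by (intro ennreal_leI) (simp add: field_simps)
  finally show ?thesis
    unfolding G.P.emeasure_eq_measure
    by (rule ennreal_le_iff[THEN iffD1, rotated]) (use K in simp)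
qed


section \<open>Relabelling the signal as a shift of the noise\<close>

definition noise_shift ::
  "real \<Rightarrow> (nat \<Rightarrow> nat \<Rightarrow> real) \<Rightarrow> (nat \<Rightarrow> nat) \<Rightarrow> nat \<times> nat \<Rightarrow> real" where
  "noise_shift \<sigma> F \<pi> = (\<lambda>(i, j). (F (\<pi> i) (\<pi> j) - F i j) / \<sigma>)"

text \<open>The change of the mean is absorbed into the noise, hence the division by \<sigma> in
  \<open>noise_shift\<close>. Symmetry of \<open>F\<close> makes the shift of the upper entries
  correct for their mirror images as well.\<close>

lemma observation_eq_shift:
  assumes "\<sigma> > 0" and sym: "\<And>i j. F i j = F j i"
  shows "observation n \<sigma> F \<pi> e
    = observation n \<sigma> F id (\<lambda>p\<in>upper_indices n. e p + noise_shift \<sigma> F \<pi> p)"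
proof -
  have "F (\<pi> i) (\<pi> j) + \<sigma> * e (min i j, max i j)
      = F i j + \<sigma> * (\<lambda>p\<in>upper_indices n. e p + noise_shift \<sigma> F \<pi> p) (min i j, max i j)"
    if "i \<in> {1..n}" "j \<in> {1..n}" for i j
  proof -
    have "(min i j, max i j) \<in> upper_indices n"
      using that by (auto simp: upper_indices_def)
    then show ?thesis
      using assms(1) sym[of i j] sym[of "\<pi> i" "\<pi> j"]
      by (cases "i \<le> j") (auto simp: noise_shift_def field_simps min_def max_def)
  qed
  then show ?thesis
    by (auto simp: observation_def symmetrize_def permuted_matrix_def fun_eq_iff restrict_def)
qed

lemma finite_upper_indices: "finite (upper_indices n)"
  by (rule finite_subset[of _ "{1..n} \<times> {1..n}"]) (auto simp: upper_indices_def)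

lemma measure_observation_law_le:
  assumes "\<sigma> > 0" "\<And>i j. F i j = F j i" and X: "X \<in> sets (matrix_space n)"
    and K: "K \<ge> exp (\<Sum>p\<in>upper_indices n. (noise_shift \<sigma> F \<pi> p)\<^sup>2)"
  shows "measure (observation_law n \<sigma> F \<pi>) X \<le> 1 / 4 + K * measure (observation_law n \<sigma> F id) X"
proof -
  define B where "B = observation n \<sigma> F id -` X \<inter> space (upper_noise n)"
  let ?s = "\<lambda>e. \<lambda>p\<in>upper_indices n. e p + noise_shift \<sigma> F \<pi> p"
  have B: "B \<in> sets (upper_noise n)"
    unfolding B_def by (rule measurable_sets[OF measurable_observation X])
  have "measure (observation_law n \<sigma> F \<pi>) X
      = measure (upper_noise n) (observation n \<sigma> F \<pi> -` X \<inter> space (upper_noise n))"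
    unfolding observation_law_def by (rule measure_distr[OF measurable_observation X])
  \<comment> \<open>Values of \<open>?s\<close> are restricted to \<open>upper_indices n\<close>,
    hence lie in the noise space, so intersecting with that space inside \<open>B\<close> removes
    nothing.\<close>
  also have "observation n \<sigma> F \<pi> -` X \<inter> space (upper_noise n) = ?s -` B \<inter> space (upper_noise n)"
    by (auto simp: B_def observation_eq_shift[OF assms(1,2), where n = n and \<pi> = \<pi>] upper_noise_def space_PiM)
  also have "measure (upper_noise n) \<dots> \<le> 1 / 4 + K * measure (upper_noise n) B"
    using measure_gaussian_shift_le[OF finite_upper_indices _ K] B unfolding upper_noise_def .
  also have "measure (upper_noise n) B = measure (observation_law n \<sigma> F id) X"
    unfolding observation_law_def B_def by (rule measure_distr[OF measurable_observation X, symmetric])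
  finally show ?thesis .
qed

section \<open>The cost of a transposition\<close>

lemma F_lin_commute: "F_lin n \<alpha> i j = F_lin n \<alpha> j i"
  by (simp add: F_lin_def abs_minus_commute)

text \<open>At most \<open>4 * n\<close> entries change, those in the two affected rows and columns.
  Each index moves by at most \<open>k\<close>, so a distance between two indices changes by at most
  \<open>2 * k\<close> and an entry of the shift is at most \<open>D\<close> in absolute
  value.\<close>

lemma sum_noise_shift_transpose_le:
  assumes "\<alpha> > 0" "\<sigma> > 0" "n > 0"
  shows "(\<Sum>p\<in>upper_indices n. (noise_shift \<sigma> (F_lin n \<alpha>) (Transposition.transpose j (j + k)) p)\<^sup>2)
    \<le> 16 * (real k)\<^sup>2 / ((\<sigma> / \<alpha>)\<^sup>2 * real n)"
proof -
  define \<pi> where "\<pi> = Transposition.transpose j (j + k)"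
  define D where "D = 2 * real k / ((\<sigma> / \<alpha>) * real n)"
  define T where "T = {j, j + k} \<times> {1..n} \<union> {1..n} \<times> {j, j + k}"
  have move: "\<bar>real (\<pi> i) - real i\<bar> \<le> real k" for i
    by (auto simp: \<pi>_def Transposition.transpose_def)
  have zero: "noise_shift \<sigma> (F_lin n \<alpha>) \<pi> p = 0" if "p \<in> upper_indices n - T" for p
  proof -
    obtain a b where p: "p = (a, b)" by (cases p)
    then have "a \<notin> {j, j + k}" "b \<notin> {j, j + k}"
      using that by (auto simp: upper_indices_def T_def)
    then have "\<pi> a = a" "\<pi> b = b" by (simp_all add: \<pi>_def transpose_apply_other)
    then show ?thesis by (simp add: p noise_shift_def)
  qed
  have bound: "(noise_shift \<sigma> (F_lin n \<alpha>) \<pi> p)\<^sup>2 \<le> D\<^sup>2" for p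
  proof (cases p)
    case (Pair a b)
    have "noise_shift \<sigma> (F_lin n \<alpha>) \<pi> p
        = (\<bar>real a - real b\<bar> - \<bar>real (\<pi> a) - real (\<pi> b)\<bar>) * (\<alpha> / (\<sigma> * n))"
      using assms by (simp add: Pair noise_shift_def F_lin_def field_simps)
    also have "\<bar>\<dots>\<bar> \<le> (2 * real k) * (\<alpha> / (\<sigma> * n))"
      unfolding abs_mult
      by (intro mult_mono) (use move[of a] move[of b] assms in \<open>auto simp: abs_mult\<close>)
    also have "\<dots> = D" using assms by (simp add: D_def)
    finally show ?thesis using power_mono[of "\<bar>noise_shift \<sigma> (F_lin n \<alpha>) \<pi> p\<bar>" D 2] by simp
  qed
  have "card T \<le> card ({j, j + k} \<times> {1..n}) + card ({1..n} \<times> {j, j + k})"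
    unfolding T_def by (rule card_Un_le)
  also have "\<dots> \<le> 2 * n + n * 2"
    unfolding card_cartesian_product by (intro add_mono mult_mono) (auto simp: card_insert_if)
  finally have card: "real (card T) \<le> 4 * real n" by linarith
  have T: "finite T" by (simp add: T_def)
  have "(\<Sum>p\<in>upper_indices n. (noise_shift \<sigma> (F_lin n \<alpha>) \<pi> p)\<^sup>2)
      = (\<Sum>p\<in>upper_indices n \<inter> T. (noise_shift \<sigma> (F_lin n \<alpha>) \<pi> p)\<^sup>2)"
    using zero by (intro sum.mono_neutral_right finite_upper_indices) auto
  also have "\<dots> \<le> (\<Sum>p\<in>T. (noise_shift \<sigma> (F_lin n \<alpha>) \<pi> p)\<^sup>2)"
    by (rule sum_mono2[OF T]) auto
  also have "\<dots> \<le> real (card T) * D\<^sup>2"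
    using sum_bounded_above[of T _ "D\<^sup>2"] bound by simp
  also have "\<dots> \<le> 4 * real n * D\<^sup>2"
    using card by (rule mult_right_mono) simp
  also have "\<dots> = 16 * (real k)\<^sup>2 / ((\<sigma> / \<alpha>)\<^sup>2 * real n)"
    using assms by (simp add: D_def power2_eq_square field_simps)
  finally show ?thesis unfolding \<pi>_def .
qed

section \<open>Separation of the transpositions in the loss\<close>

lemma L_max_less_cases:
  assumes "L_max n v \<pi> < t" "n > 0"
  obtains "\<And>i. i \<in> {1..n} \<Longrightarrow> \<bar>v i - real (\<pi> i)\<bar> < n * t"
  | "\<And>i. i \<in> {1..n} \<Longrightarrow> \<bar>v i - rev_perm n \<pi> i\<bar> < n * t"
proof -
  have "min (MAX i\<in>{1..n}. \<bar>v i - real (\<pi> i)\<bar>) (MAX i\<in>{1..n}. \<bar>v i - rev_perm n \<pi> i\<bar>) < n * t"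
    using assms by (simp only: L_max_def) (simp add: field_simps)
  then show ?thesis
    using that assms(2) by (auto simp: min_less_iff_disj)
qed

text \<open>If both approximations use the same orientation, coordinate \<open>j\<close> is
  decisive: the two transpositions send it to \<open>j + k\<close> and to \<open>j\<close>. If the
  orientations differ, coordinate \<open>n\<close> is: both transpositions fix it because
  \<open>2 * k < n\<close>, so \<open>v n\<close> would be close to both \<open>n\<close> and
  1.\<close>

lemma L_max_transpose_separated:
  fixes t :: real
  assumes "L_max n v (Transposition.transpose j (j + k)) < t" "L_max n v (Transposition.transpose l (l + k)) < t"
    and "j \<in> {1..k}" "l \<in> {1..k}" "2 * k < n" "2 * (n * t) \<le> k"
  shows "j = l"
proof (rule ccontr)
  assume "j \<noteq> l"
  have n: "n > 0" "j \<in> {1..n}" "n \<in> {1..n}" using assms by auto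
  have j: "Transposition.transpose j (j + k) j = j + k" "Transposition.transpose l (l + k) j = j"
    using assms \<open>j \<noteq> l\<close> by (auto simp: Transposition.transpose_def)
  have nn: "Transposition.transpose j (j + k) n = n" "Transposition.transpose l (l + k) n = n"
    using assms by (auto simp: Transposition.transpose_def)
  have dist: "real (j + k) - real j \<ge> 2 * (n * t)" "real n - 1 \<ge> 2 * (n * t)"
    using assms(5,6) by auto
  from assms(1) n(1) show False
  proof (cases rule: L_max_less_cases)
    case 1
    note j1 = 1[OF n(2)] and n1 = 1[OF n(3)]
    from assms(2) n(1) show ?thesis
    proof (cases rule: L_max_less_cases)
      case 1
      show ?thesis using j1 1[OF n(2)] dist(1) unfolding j by linarith
    next
      case 2
      show ?thesis using n1 2[OF n(3)] dist(2) unfolding nn rev_perm_def by linarith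
    qed
  next
    case 2
    note j2 = 2[OF n(2)] and n2 = 2[OF n(3)]
    from assms(2) n(1) show ?thesis
    proof (cases rule: L_max_less_cases)
      case 1
      show ?thesis using n2 1[OF n(3)] dist(2) unfolding nn rev_perm_def by linarith
    next
      case 2
      show ?thesis using j2 2[OF n(2)] dist(1) unfolding j rev_perm_def by linarith
    qed
  qed
qed

section \<open>The lower bound for a fixed estimator\<close>

lemma exists_bad_transposition:
  fixes t :: real
  assumes "\<alpha> > 0" "\<sigma> > 0" "2 * k < n" "2 * (n * t) \<le> k"
    and K: "4 * exp (16 * (real k)\<^sup>2 / ((\<sigma> / \<alpha>)\<^sup>2 * real n)) < k"
    and h: "h \<in> estimators n"
  obtains j where "j \<in> {1..k}"
    "measure (observation_law n \<sigma> (F_lin n \<alpha>) (Transposition.transpose j (j + k)))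
       {A \<in> space (observation_law n \<sigma> (F_lin n \<alpha>) (Transposition.transpose j (j + k))).
          L_max n (h A) (Transposition.transpose j (j + k)) \<ge> t} \<ge> 1 / 2"
proof (rule ccontr)
  assume contra: "\<not> thesis"
  define P where "P \<pi> = observation_law n \<sigma> (F_lin n \<alpha>) \<pi>" for \<pi>
  define \<tau> where "\<tau> j = Transposition.transpose j (j + k)" for j
  define K where "K = exp (16 * (real k)\<^sup>2 / ((\<sigma> / \<alpha>)\<^sup>2 * real n))"
  \<comment> \<open>The accuracy event is taken in \<open>matrix_space n\<close>, common to all the
    laws, so that it can be measured under \<open>P id\<close> as well as under
    \<open>P (\<tau> j)\<close>.\<close>
  define X where "X j = {A \<in> space (matrix_space n). L_max n (h A) (\<tau> j) < t}" for j
  have prob: "prob_space (P \<pi>)" for \<pi> unfolding P_def by (rule prob_space_observation_law)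
  interpret P0: prob_space "P id" by (rule prob)
  have space: "space (P \<pi>) = space (matrix_space n)" for \<pi>
    unfolding P_def by (rule sets_eq_imp_space_eq[OF sets_observation_law])
  have K0: "K > 0" by (simp add: K_def)
  have X: "X j \<in> sets (P \<pi>)"
    and big: "j \<in> {1..k} \<Longrightarrow> measure (P (\<tau> j)) (X j) > 1 / 2" for j \<pi>
  proof -
    let ?Y = "{A \<in> space (P (\<tau> j)). L_max n (h A) (\<tau> j) \<ge> t}"
    have Y: "?Y \<in> sets (P (\<tau> j))" unfolding P_def by (rule loss_event_in_sets[OF h])
    have XY: "X j = space (P (\<tau> j)) - ?Y" by (auto simp: X_def space)
    then have "X j \<in> sets (P (\<tau> j))" using Y by auto
    then show "X j \<in> sets (P \<pi>)" by (simp add: P_def sets_observation_law)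
    assume "j \<in> {1..k}"
    then have "measure (P (\<tau> j)) ?Y < 1 / 2"
      using contra that[of j] unfolding P_def \<tau>_def by (meson not_le)
    then show "measure (P (\<tau> j)) (X j) > 1 / 2"
      using prob_space.prob_compl[OF prob Y] XY by simp
  qed
  \<comment> \<open>Of the probability above 1/2 under \<open>P (\<tau> j)\<close>, the change of
    measure loses 1/4; the other 1/4 survives, divided by \<open>K\<close>.\<close>
  have small: "1 / (4 * K) \<le> measure (P id) (X j)" if "j \<in> {1..k}" for j
  proof -
    have "measure (P (\<tau> j)) (X j) \<le> 1 / 4 + K * measure (P id) (X j)"
      unfolding P_def
    proof (rule measure_observation_law_le[OF assms(2) F_lin_commute])
      show "X j \<in> sets (matrix_space n)" using X[of j id] by (simp add: P_def sets_observation_law)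
      show "exp (\<Sum>p\<in>upper_indices n. (noise_shift \<sigma> (F_lin n \<alpha>) (\<tau> j) p)\<^sup>2) \<le> K"
        using sum_noise_shift_transpose_le[OF assms(1,2), of n j k] assms(3)
        by (simp add: K_def \<tau>_def)
    qed
    then show ?thesis using big[OF that] K0 by (simp add: field_simps)
  qed
  have disj: "disjoint_family_on X {1..k}"
    unfolding disjoint_family_on_def
  proof (intro ballI impI)
    fix j l assume jl: "j \<in> {1..k}" "l \<in> {1..k}" "j \<noteq> l"
    have False if "A \<in> X j" "A \<in> X l" for A
      using that L_max_transpose_separated[OF _ _ jl(1,2) assms(3,4), of "h A"] jl(3)
      unfolding X_def \<tau>_def by blast
    then show "X j \<inter> X l = {}" by blast
  qed
  \<comment> \<open>The \<open>k\<close> disjoint accuracy events share a total mass of at most 1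
    under the identity.\<close>
  have "k * (1 / (4 * K)) \<le> (\<Sum>j\<in>{1..k}. measure (P id) (X j))"
    using sum_bounded_below[of "{1..k}" "1 / (4 * K)"] small by simp
  also have "\<dots> = measure (P id) (\<Union>j\<in>{1..k}. X j)"
    using X disj by (intro P0.finite_measure_finite_Union[symmetric]) auto
  also have "\<dots> \<le> 1" by (rule P0.prob_le_1)
  finally have "k \<le> 4 * K" using K0 by (simp add: field_simps)
  then show False using K by (simp add: K_def)
qed

section \<open>Choice of the scale and conclusion\<close>

text \<open>Here \<open>r\<close> stands for \<open>\<sigma> / \<alpha>\<close>. With
  \<open>k\<close> of order \<open>r * sqrt (n * ln n)\<close> the exponent is a constant times
  \<open>ln n\<close>; the constants keep it at most \<open>ln n / 4\<close>, so the exponential is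
  at most \<open>n powr (1 / 4)\<close>, far below \<open>k\<close>.\<close>

lemma eventually_scales:
  fixes r :: real
  assumes "r > 0"
  shows "\<forall>\<^sub>F n in sequentially. \<exists>k::nat. 2 * k < n \<and>
    2 * (real n * (1 / 24 * r * sqrt (ln (real n) / real n))) \<le> real k \<and>
    4 * exp (16 * (real k)\<^sup>2 / (r\<^sup>2 * real n)) < real k"
proof -
  \<comment> \<open>The first fact absorbs the rounding of \<open>k\<close>, raising the factor
    \<open>r / 12\<close> to at most \<open>r / 12 + r / 24 = r / 8\<close>. The second gives
    \<open>2 * k < n\<close>, the third the exponential condition.\<close>
  have 1: "\<forall>\<^sub>F n in sequentially. r / 24 * sqrt (real n * ln (real n)) \<ge> 1"
    using assms by real_asymp
  have 2: "\<forall>\<^sub>F n in sequentially. r / 4 * sqrt (real n * ln (real n)) < real n"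
    using assms by real_asymp
  have 3: "\<forall>\<^sub>F n in sequentially. 4 * real n powr (1 / 4) < r / 12 * sqrt (real n * ln (real n))"
    using assms by real_asymp
  from 1 2 3 eventually_gt_at_top[of 1] show ?thesis
  proof eventually_elim
    case (elim n)
    define s where "s = sqrt (real n * ln (real n))"
    \<comment> \<open>The factor \<open>r / 12\<close> is twice the \<open>r / 24\<close> of the
      loss threshold, as the separation requires.\<close>
    define k where "k = nat \<lceil>r / 12 * s\<rceil>"
    have s: "s \<ge> 0" "s\<^sup>2 = n * ln n" using elim by (auto simp: s_def)
    have k: "r / 12 * s \<le> k" "k \<le> r / 12 * s + 1"
      using s assms by (auto simp: k_def intro: of_nat_ceiling)
    then have k8: "k \<le> r / 8 * s" using elim(1) by (simp add: s_def)
    have "real n * sqrt (ln n / n) = s"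
      using elim(4) by (simp add: s_def real_sqrt_divide real_sqrt_mult field_simps)
    then have t: "2 * (real n * (1 / 24 * r * sqrt (ln n / n))) \<le> k"
      using k(1) by (simp add: algebra_simps)
    have "(real k)\<^sup>2 \<le> (r / 8 * s)\<^sup>2" using k8 by (intro power_mono) auto
    also have "\<dots> = r\<^sup>2 * n * ln n / 64" by (simp add: power_mult_distrib power_divide s)
    finally have "16 * (real k)\<^sup>2 / (r\<^sup>2 * n) \<le> 1 / 4 * ln n"
      using elim(4) assms by (simp add: field_simps)
    then have "4 * exp (16 * (real k)\<^sup>2 / (r\<^sup>2 * n)) \<le> 4 * n powr (1 / 4)"
      using elim(4) by (simp add: powr_def)
    also have "\<dots> < k" using elim(3) k(1) by (simp add: s_def)
    finally have e: "4 * exp (16 * (real k)\<^sup>2 / (r\<^sup>2 * n)) < k" .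
    have "2 * k < n" using k8 elim(2) by (simp add: s_def)
    then show ?case using t e by blast
  qed
qed

theorem theorem4p3:
  shows "\<exists>c::real. c > 0 \<and>
    (\<forall>\<alpha> \<sigma> :: real. \<alpha> > 0 \<longrightarrow> \<sigma> > 0 \<longrightarrow>
      (\<exists>C::real. \<forall>n::nat. real n \<ge> C \<longrightarrow>
        (INF h \<in> estimators n. SUP \<pi> \<in> {\<pi>. \<pi> permutes {1..n}}.
          measure (observation_law n \<sigma> (F_lin n \<alpha>) \<pi>)
            {A \<in> space (observation_law n \<sigma> (F_lin n \<alpha>) \<pi>).
               L_max n (h A) \<pi> \<ge> c * (\<sigma> / \<alpha>) * sqrt (ln (real n) / real n)})
        \<ge> 1 / 2))"
\<comment> \<open>The constant is the one for which \<open>eventually_scales\<close> supplies a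
  suitable \<open>k\<close>.\<close>
proof (rule exI[of _ "1 / 24"], intro conjI allI impI)
  fix \<alpha> \<sigma> :: real
  assume pos: "\<alpha> > 0" "\<sigma> > 0"
  obtain N where N: "\<And>n. n \<ge> N \<Longrightarrow> \<exists>k::nat. 2 * k < n \<and>
      2 * (real n * (1 / 24 * (\<sigma> / \<alpha>) * sqrt (ln (real n) / real n))) \<le> real k \<and>
      4 * exp (16 * (real k)\<^sup>2 / ((\<sigma> / \<alpha>)\<^sup>2 * real n)) < real k"
    using eventually_scales[OF divide_pos_pos[OF pos(2,1)]] unfolding eventually_sequentially
    by blast
  show "\<exists>C::real. \<forall>n::nat. real n \<ge> C \<longrightarrow>
        (INF h \<in> estimators n. SUP \<pi> \<in> {\<pi>. \<pi> permutes {1..n}}.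
          measure (observation_law n \<sigma> (F_lin n \<alpha>) \<pi>)
            {A \<in> space (observation_law n \<sigma> (F_lin n \<alpha>) \<pi>).
               L_max n (h A) \<pi> \<ge> 1 / 24 * (\<sigma> / \<alpha>) * sqrt (ln (real n) / real n)})
        \<ge> 1 / 2"
  proof (intro exI[of _ "real N"] allI impI cINF_greatest estimators_nonempty)
    fix n h
    assume n: "real N \<le> real n" and h: "h \<in> estimators n"
    define t where "t = 1 / 24 * (\<sigma> / \<alpha>) * sqrt (ln (real n) / real n)"
    obtain k where k: "2 * k < n" "2 * (n * t) \<le> k"
      "4 * exp (16 * (real k)\<^sup>2 / ((\<sigma> / \<alpha>)\<^sup>2 * real n)) < k"
      using N[of n] n unfolding t_def of_nat_le_iff by blast
    obtain j where j: "j \<in> {1..k}"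
      "measure (observation_law n \<sigma> (F_lin n \<alpha>) (Transposition.transpose j (j + k)))
         {A \<in> space (observation_law n \<sigma> (F_lin n \<alpha>) (Transposition.transpose j (j + k))).
            L_max n (h A) (Transposition.transpose j (j + k)) \<ge> t} \<ge> 1 / 2"
      using exists_bad_transposition[OF pos k h] .
    have perm: "Transposition.transpose j (j + k) permutes {1..n}"
      using j(1) k(1) by (intro permutes_swap_id) auto
    \<comment> \<open>The supremum is taken in the reals, so it dominates its members only once the
      family is known to be bounded; probabilities are at most 1.\<close>
    have bdd: "bdd_above ((\<lambda>\<pi>. measure (observation_law n \<sigma> (F_lin n \<alpha>) \<pi>)
        {A \<in> space (observation_law n \<sigma> (F_lin n \<alpha>) \<pi>). L_max n (h A) \<pi> \<ge> t})
        ` {\<pi>. \<pi> permutes {1..n}})"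
      by (rule bdd_aboveI2[where M = 1])
        (rule prob_space.prob_le_1[OF prob_space_observation_law])
    show "1 / 2 \<le> (SUP \<pi> \<in> {\<pi>. \<pi> permutes {1..n}}.
        measure (observation_law n \<sigma> (F_lin n \<alpha>) \<pi>)
          {A \<in> space (observation_law n \<sigma> (F_lin n \<alpha>) \<pi>).
             L_max n (h A) \<pi> \<ge> 1 / 24 * (\<sigma> / \<alpha>) * sqrt (ln (real n) / real n)})"
      unfolding t_def[symmetric]
      by (rule order_trans[OF j(2)], rule cSUP_upper[OF _ bdd]) (use perm in simp)
  qed
qed simp

end
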